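(* Let $K$ be a commutative ring, let $A$ be an associative unital $K$-algebra, let $M$ be an $A^{\mathrm{ev}}$-module and let $D:A\to M$ be a $K$-linear derivation. Let $E_D$ be the $A^{\mathrm{ev}}$-module $$E_D=\frac{(A\otimes A)\oplus M}{\big\langle (a\otimes b-1\otimes ab,\;D(a)b)\ \big|\ a,b\in A\big\rangle},$$ the quotient by the additive subgroup generated by the displayed elements (which is a sub-bimodule). Then $$\mathrm{Ker}(D)\cap Z_M(A)=\mathrm{Ker}\big(D|_{Z_M(A)}\big)=Z_{E_D}(A).$$
   Context: Write $\otimes=\otimes_K$ and $A^{\mathrm{ev}}=A\otimes A^{\mathrm{op}}$; $A^{\mathrm{ev}}$-modules are $A$-bimodules with symmetric $K$-action. $A\otimes A$ carries the outer bimodule structure $x(a\otimes b)y=xa\otimes by$. A $K$-linear derivation $D:A\to M$ satisfies $D(ab)=aD(b)+D(a)b$. For an $A^{\mathrm{ev}}$-module $N$, the $N$-relative center of $A$ is $Z_N(A)=\{z\in Z(A)\mid zn=nz\text{ for all }n\in N\}$, where $Z(A)$ is the center of $A$. *)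

theory Defs
  imports "HOL-Algebra.Module" "HOL-Algebra.AbelCoset" "HOL-Algebra.Free_Abelian_Groups"
begin

section \<open>Algebras, bimodules and derivations\<close>

text \<open>
  The locale \<^locale>\<open>algebra\<close> of the library requires a commutative algebra, hence the following
  locale. Neither \<open>K\<close> nor \<open>A\<close> is required to be nonzero.
\<close>

locale assoc_algebra = module K A + ring A
  for K :: "('k, 'c) ring_scheme" and A :: "('k, 'a, 'd) module_scheme" +
  assumes smult_mult_left:
      "\<lbrakk>k \<in> carrier K; a \<in> carrier A; b \<in> carrier A\<rbrakk> \<Longrightarrow>
        (k \<odot>\<^bsub>A\<^esub> a) \<otimes>\<^bsub>A\<^esub> b = k \<odot>\<^bsub>A\<^esub> (a \<otimes>\<^bsub>A\<^esub> b)"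
    and smult_mult_right:
      "\<lbrakk>k \<in> carrier K; a \<in> carrier A; b \<in> carrier A\<rbrakk> \<Longrightarrow>
        a \<otimes>\<^bsub>A\<^esub> (k \<odot>\<^bsub>A\<^esub> b) = k \<odot>\<^bsub>A\<^esub> (a \<otimes>\<^bsub>A\<^esub> b)"

text \<open>
  Modules over the enveloping algebra, as bimodules with symmetric action of the ground ring.
  As in the library's record \<open>module\<close>, the inherited fields \<open>mult\<close> and \<open>one\<close> carry no meaning.
\<close>

record ('k, 'a, 'm) bimodule = "('k, 'm) module" +
  lact :: "'a \<Rightarrow> 'm \<Rightarrow> 'm"
  ract :: "'m \<Rightarrow> 'a \<Rightarrow> 'm"

locale bimodule = A: assoc_algebra K A + N: module K N
  for K :: "('k, 'c) ring_scheme" and A :: "('k, 'a, 'd) module_scheme"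
    and N :: "('k, 'a, 'm, 'e) bimodule_scheme" +
  assumes lact_closed:
      "\<lbrakk>a \<in> carrier A; n \<in> carrier N\<rbrakk> \<Longrightarrow> lact N a n \<in> carrier N"
    and ract_closed:
      "\<lbrakk>a \<in> carrier A; n \<in> carrier N\<rbrakk> \<Longrightarrow> ract N n a \<in> carrier N"
    and lact_add_left:
      "\<lbrakk>a \<in> carrier A; b \<in> carrier A; n \<in> carrier N\<rbrakk> \<Longrightarrow>
        lact N (a \<oplus>\<^bsub>A\<^esub> b) n = lact N a n \<oplus>\<^bsub>N\<^esub> lact N b n"
    and lact_add_right:
      "\<lbrakk>a \<in> carrier A; n \<in> carrier N; n' \<in> carrier N\<rbrakk> \<Longrightarrow>
        lact N a (n \<oplus>\<^bsub>N\<^esub> n') = lact N a n \<oplus>\<^bsub>N\<^esub> lact N a n'"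
    and ract_add_left:
      "\<lbrakk>a \<in> carrier A; n \<in> carrier N; n' \<in> carrier N\<rbrakk> \<Longrightarrow>
        ract N (n \<oplus>\<^bsub>N\<^esub> n') a = ract N n a \<oplus>\<^bsub>N\<^esub> ract N n' a"
    and ract_add_right:
      "\<lbrakk>a \<in> carrier A; b \<in> carrier A; n \<in> carrier N\<rbrakk> \<Longrightarrow>
        ract N n (a \<oplus>\<^bsub>A\<^esub> b) = ract N n a \<oplus>\<^bsub>N\<^esub> ract N n b"
    and lact_one: "n \<in> carrier N \<Longrightarrow> lact N \<one>\<^bsub>A\<^esub> n = n"
    and ract_one: "n \<in> carrier N \<Longrightarrow> ract N n \<one>\<^bsub>A\<^esub> = n"
    and lact_mult:
      "\<lbrakk>a \<in> carrier A; b \<in> carrier A; n \<in> carrier N\<rbrakk> \<Longrightarrow>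
        lact N (a \<otimes>\<^bsub>A\<^esub> b) n = lact N a (lact N b n)"
    and ract_mult:
      "\<lbrakk>a \<in> carrier A; b \<in> carrier A; n \<in> carrier N\<rbrakk> \<Longrightarrow>
        ract N n (a \<otimes>\<^bsub>A\<^esub> b) = ract N (ract N n a) b"
    and lact_ract:
      "\<lbrakk>a \<in> carrier A; b \<in> carrier A; n \<in> carrier N\<rbrakk> \<Longrightarrow>
        lact N a (ract N n b) = ract N (lact N a n) b"
    and lact_smult:
      "\<lbrakk>k \<in> carrier K; a \<in> carrier A; n \<in> carrier N\<rbrakk> \<Longrightarrow>
        lact N (k \<odot>\<^bsub>A\<^esub> a) n = k \<odot>\<^bsub>N\<^esub> lact N a n"
    and ract_smult:
      "\<lbrakk>k \<in> carrier K; a \<in> carrier A; n \<in> carrier N\<rbrakk> \<Longrightarrow>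
        ract N n (k \<odot>\<^bsub>A\<^esub> a) = k \<odot>\<^bsub>N\<^esub> ract N n a"

locale derivation = bimodule K A M
  for K :: "('k, 'c) ring_scheme" and A :: "('k, 'a, 'd) module_scheme"
    and M :: "('k, 'a, 'm, 'e) bimodule_scheme" +
  fixes D :: "'a \<Rightarrow> 'm"
  assumes D_closed: "a \<in> carrier A \<Longrightarrow> D a \<in> carrier M"
    and D_add:
      "\<lbrakk>a \<in> carrier A; b \<in> carrier A\<rbrakk> \<Longrightarrow> D (a \<oplus>\<^bsub>A\<^esub> b) = D a \<oplus>\<^bsub>M\<^esub> D b"
    and D_smult:
      "\<lbrakk>k \<in> carrier K; a \<in> carrier A\<rbrakk> \<Longrightarrow> D (k \<odot>\<^bsub>A\<^esub> a) = k \<odot>\<^bsub>M\<^esub> D a"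
    and D_mult:
      "\<lbrakk>a \<in> carrier A; b \<in> carrier A\<rbrakk> \<Longrightarrow>
        D (a \<otimes>\<^bsub>A\<^esub> b) = lact M a (D b) \<oplus>\<^bsub>M\<^esub> ract M (D a) b"

definition ring_center :: "('a, 'd) ring_scheme \<Rightarrow> 'a set"
  where "ring_center A = {z \<in> carrier A. \<forall>a \<in> carrier A. z \<otimes>\<^bsub>A\<^esub> a = a \<otimes>\<^bsub>A\<^esub> z}"

definition rel_center ::
    "('a, 'd) ring_scheme \<Rightarrow> ('k, 'a, 'm, 'e) bimodule_scheme \<Rightarrow> 'a set"
  where "rel_center A N = {z \<in> ring_center A. \<forall>n \<in> carrier N. lact N z n = ract N n z}"


section \<open>Quotients and sums of bimodules\<close>

text \<open>
  The map that \<open>f\<close> induces into the quotient of \<open>G\<close> by \<open>H\<close>, evaluated at a coset \<open>C\<close>. For an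
  additive \<open>f\<close> that respects the subgroups the union is one coset; see
  \<open>coset_map_r_coset\<close> below.
\<close>

definition coset_map ::
    "('b, 'e) monoid_scheme \<Rightarrow> 'b set \<Rightarrow> ('a \<Rightarrow> 'b) \<Rightarrow> 'a set \<Rightarrow> 'b set"
  where "coset_map G H f C = (\<Union>x\<in>C. H #>\<^bsub>G\<^esub> f x)"

definition quot_bimodule ::
    "('k, 'a, 'm, 'e) bimodule_scheme \<Rightarrow> 'm set \<Rightarrow> ('k, 'a, 'm set) bimodule"
  where "quot_bimodule N H =
    \<lparr>carrier = a_rcosets\<^bsub>N\<^esub> H, mult = undefined, one = undefined,
     ring.zero = H, add = set_add N,
     smult = (\<lambda>k. coset_map (add_monoid N) H (\<lambda>n. k \<odot>\<^bsub>N\<^esub> n)),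
     lact = (\<lambda>a. coset_map (add_monoid N) H (\<lambda>n. lact N a n)),
     ract = (\<lambda>C a. coset_map (add_monoid N) H (\<lambda>n. ract N n a) C)\<rparr>"

definition sum_bimodule ::
    "('k, 'a, 'm, 'e) bimodule_scheme \<Rightarrow> ('k, 'a, 'n, 'f) bimodule_scheme \<Rightarrow>
      ('k, 'a, 'm \<times> 'n) bimodule"
  where "sum_bimodule M N =
    \<lparr>carrier = carrier M \<times> carrier N, mult = undefined, one = undefined,
     ring.zero = (\<zero>\<^bsub>M\<^esub>, \<zero>\<^bsub>N\<^esub>),
     add = (\<lambda>(m, n) (m', n'). (m \<oplus>\<^bsub>M\<^esub> m', n \<oplus>\<^bsub>N\<^esub> n')),
     smult = (\<lambda>k (m, n). (k \<odot>\<^bsub>M\<^esub> m, k \<odot>\<^bsub>N\<^esub> n)),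
     lact = (\<lambda>a (m, n). (lact M a m, lact N a n)),
     ract = (\<lambda>(m, n) a. (ract M m a, ract N n a))\<rparr>"


section \<open>The tensor product\<close>

text \<open>
  The tensor product of two \<open>K\<close>-modules is the free abelian group on pairs modulo the
  subgroup generated by the bilinearity and balancing relations.
\<close>

definition tensor_relations ::
    "('k, 'c) ring_scheme \<Rightarrow> ('k, 'm, 'e) module_scheme \<Rightarrow> ('k, 'n, 'f) module_scheme \<Rightarrow>
      ('m \<times> 'n \<Rightarrow>\<^sub>0 int) set"
  where "tensor_relations K M N =
    {frag_of (x \<oplus>\<^bsub>M\<^esub> x', y) - frag_of (x, y) - frag_of (x', y) | x x' y.
        x \<in> carrier M \<and> x' \<in> carrier M \<and> y \<in> carrier N} \<union>
    {frag_of (x, y \<oplus>\<^bsub>N\<^esub> y') - frag_of (x, y) - frag_of (x, y') | x y y'.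
        x \<in> carrier M \<and> y \<in> carrier N \<and> y' \<in> carrier N} \<union>
    {frag_of (k \<odot>\<^bsub>M\<^esub> x, y) - frag_of (x, k \<odot>\<^bsub>N\<^esub> y) | k x y.
        k \<in> carrier K \<and> x \<in> carrier M \<and> y \<in> carrier N}"

abbreviation pair_group ::
    "('m, 'e) ring_scheme \<Rightarrow> ('n, 'f) ring_scheme \<Rightarrow> ('m \<times> 'n \<Rightarrow>\<^sub>0 int) monoid"
  where "pair_group M N \<equiv> free_Abelian_group (carrier M \<times> carrier N)"

definition tensor_kernel ::
    "('k, 'c) ring_scheme \<Rightarrow> ('k, 'm, 'e) module_scheme \<Rightarrow> ('k, 'n, 'f) module_scheme \<Rightarrow>
      ('m \<times> 'n \<Rightarrow>\<^sub>0 int) set"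
  where "tensor_kernel K M N = generate (pair_group M N) (tensor_relations K M N)"

definition pure_tensor ::
    "('k, 'c) ring_scheme \<Rightarrow> ('k, 'm, 'e) module_scheme \<Rightarrow> ('k, 'n, 'f) module_scheme \<Rightarrow>
      'm \<Rightarrow> 'n \<Rightarrow> ('m \<times> 'n \<Rightarrow>\<^sub>0 int) set"
  where "pure_tensor K M N x y = tensor_kernel K M N #>\<^bsub>pair_group M N\<^esub> frag_of (x, y)"

text \<open>The endomorphism of the tensor product that sends each pure tensor of \<open>x\<close> and \<open>y\<close> to that
  of \<open>f x\<close> and \<open>g y\<close>.\<close>

definition tensor_map ::
    "('k, 'c) ring_scheme \<Rightarrow> ('k, 'm, 'e) module_scheme \<Rightarrow> ('k, 'n, 'f) module_scheme \<Rightarrow>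
      ('m \<Rightarrow> 'm) \<Rightarrow> ('n \<Rightarrow> 'n) \<Rightarrow> ('m \<times> 'n \<Rightarrow>\<^sub>0 int) set \<Rightarrow> ('m \<times> 'n \<Rightarrow>\<^sub>0 int) set"
  where "tensor_map K M N f g =
    coset_map (pair_group M N) (tensor_kernel K M N)
      (frag_extend (\<lambda>(x, y). frag_of (f x, g y)))"

definition tensor_square ::
    "('k, 'c) ring_scheme \<Rightarrow> ('k, 'a, 'd) module_scheme \<Rightarrow>
      ('k, 'a, ('a \<times> 'a \<Rightarrow>\<^sub>0 int) set) bimodule"
  where "tensor_square K A =
    \<lparr>carrier = rcosets\<^bsub>pair_group A A\<^esub> tensor_kernel K A A,
     mult = undefined, one = undefined,
     ring.zero = tensor_kernel K A A,
     add = set_mult (pair_group A A),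
     smult = (\<lambda>k. tensor_map K A A (\<lambda>a. k \<odot>\<^bsub>A\<^esub> a) (\<lambda>b. b)),
     lact = (\<lambda>x. tensor_map K A A (\<lambda>a. x \<otimes>\<^bsub>A\<^esub> a) (\<lambda>b. b)),
     ract = (\<lambda>t y. tensor_map K A A (\<lambda>a. a) (\<lambda>b. b \<otimes>\<^bsub>A\<^esub> y) t)\<rparr>"


section \<open>The bimodule of a derivation\<close>

definition derivation_relations ::
    "('k, 'c) ring_scheme \<Rightarrow> ('k, 'a, 'd) module_scheme \<Rightarrow>
      ('k, 'a, 'm, 'e) bimodule_scheme \<Rightarrow> ('a \<Rightarrow> 'm) \<Rightarrow>
      (('a \<times> 'a \<Rightarrow>\<^sub>0 int) set \<times> 'm) set"
  where "derivation_relations K A M D =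
    {(pure_tensor K A A a b \<ominus>\<^bsub>tensor_square K A\<^esub> pure_tensor K A A \<one>\<^bsub>A\<^esub> (a \<otimes>\<^bsub>A\<^esub> b),
      ract M (D a) b) | a b. a \<in> carrier A \<and> b \<in> carrier A}"

definition derivation_bimodule ::
    "('k, 'c) ring_scheme \<Rightarrow> ('k, 'a, 'd) module_scheme \<Rightarrow>
      ('k, 'a, 'm, 'e) bimodule_scheme \<Rightarrow> ('a \<Rightarrow> 'm) \<Rightarrow>
      ('k, 'a, (('a \<times> 'a \<Rightarrow>\<^sub>0 int) set \<times> 'm) set) bimodule"
  where "derivation_bimodule K A M D =
    quot_bimodule (sum_bimodule (tensor_square K A) M)
      (generate (add_monoid (sum_bimodule (tensor_square K A) M))
        (derivation_relations K A M D))"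


section \<open>The constructions are bimodules\<close>

lemma coset_map_r_coset:
  assumes "comm_group G" and "subgroup H G" and "f \<in> hom G G" and "f ` H \<subseteq> H" and "x \<in> carrier G"
  shows "coset_map G H f (H #>\<^bsub>G\<^esub> x) = H #>\<^bsub>G\<^esub> f x"
proof -
  interpret G: comm_group G by fact
  interpret H: subgroup H G by fact
  have fx: "f x \<in> carrier G" using assms by (auto simp: hom_def)
  have *: "H #>\<^bsub>G\<^esub> f y = H #>\<^bsub>G\<^esub> f x" if y: "y \<in> H #>\<^bsub>G\<^esub> x" for y
  proof -
    obtain h where h: "h \<in> H" "y = h \<otimes>\<^bsub>G\<^esub> x" using y by (auto simp: r_coset_def)
    have fh: "f h \<in> H" using h assms by auto
    have "f y = f h \<otimes>\<^bsub>G\<^esub> f x" using assms h H.mem_carrier by (auto simp: hom_def)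
    then have "H #>\<^bsub>G\<^esub> f y = (H #>\<^bsub>G\<^esub> f h) #>\<^bsub>G\<^esub> f x"
      using G.coset_mult_assoc[OF H.subset H.mem_carrier[OF fh] fx] by simp
    also have "H #>\<^bsub>G\<^esub> f h = H" by (rule H.rcos_const[OF G.is_group fh])
    finally show ?thesis .
  qed
  have "x \<in> H #>\<^bsub>G\<^esub> x" by (rule G.rcos_self[OF assms(5,2)]) 
  then have ne: "H #>\<^bsub>G\<^esub> x \<noteq> {}" by blast
  have "coset_map G H f (H #>\<^bsub>G\<^esub> x) = (\<Union>y\<in>H #>\<^bsub>G\<^esub> x. H #>\<^bsub>G\<^esub> f x)"
    unfolding coset_map_def by (rule SUP_cong[OF refl *])
  then show ?thesis by (simp only: cSUP_const[OF ne])
qed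

lemma bimodule_quotient:
  assumes A: "assoc_algebra K A" and G: "comm_group G" and H: "subgroup H G"
    and s: "\<And>k. k \<in> carrier K \<Longrightarrow> s k \<in> hom G G \<and> s k ` H \<subseteq> H"
    and l: "\<And>a. a \<in> carrier A \<Longrightarrow> l a \<in> hom G G \<and> l a ` H \<subseteq> H"
    and r: "\<And>a. a \<in> carrier A \<Longrightarrow> (\<lambda>n. r n a) \<in> hom G G \<and> (\<lambda>n. r n a) ` H \<subseteq> H"
    and sadd: "\<And>k k' x. k \<in> carrier K \<Longrightarrow> k' \<in> carrier K \<Longrightarrow> x \<in> carrier G \<Longrightarrow>
        H #>\<^bsub>G\<^esub> s (k \<oplus>\<^bsub>K\<^esub> k') x = H #>\<^bsub>G\<^esub> (s k x \<otimes>\<^bsub>G\<^esub> s k' x)"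
    and smul: "\<And>k k' x. k \<in> carrier K \<Longrightarrow> k' \<in> carrier K \<Longrightarrow> x \<in> carrier G \<Longrightarrow>
        H #>\<^bsub>G\<^esub> s (k \<otimes>\<^bsub>K\<^esub> k') x = H #>\<^bsub>G\<^esub> (s k (s k' x))"
    and sone: "\<And>x. x \<in> carrier G \<Longrightarrow> H #>\<^bsub>G\<^esub> s \<one>\<^bsub>K\<^esub> x = H #>\<^bsub>G\<^esub> x"
    and ladd: "\<And>a b x. a \<in> carrier A \<Longrightarrow> b \<in> carrier A \<Longrightarrow> x \<in> carrier G \<Longrightarrow>
        H #>\<^bsub>G\<^esub> l (a \<oplus>\<^bsub>A\<^esub> b) x = H #>\<^bsub>G\<^esub> (l a x \<otimes>\<^bsub>G\<^esub> l b x)"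
    and radd: "\<And>a b x. a \<in> carrier A \<Longrightarrow> b \<in> carrier A \<Longrightarrow> x \<in> carrier G \<Longrightarrow>
        H #>\<^bsub>G\<^esub> r x (a \<oplus>\<^bsub>A\<^esub> b) = H #>\<^bsub>G\<^esub> (r x a \<otimes>\<^bsub>G\<^esub> r x b)"
    and lone: "\<And>x. x \<in> carrier G \<Longrightarrow> H #>\<^bsub>G\<^esub> l \<one>\<^bsub>A\<^esub> x = H #>\<^bsub>G\<^esub> x"
    and rone: "\<And>x. x \<in> carrier G \<Longrightarrow> H #>\<^bsub>G\<^esub> r x \<one>\<^bsub>A\<^esub> = H #>\<^bsub>G\<^esub> x"
    and lmul: "\<And>a b x. a \<in> carrier A \<Longrightarrow> b \<in> carrier A \<Longrightarrow> x \<in> carrier G \<Longrightarrow>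
        H #>\<^bsub>G\<^esub> l (a \<otimes>\<^bsub>A\<^esub> b) x = H #>\<^bsub>G\<^esub> (l a (l b x))"
    and rmul: "\<And>a b x. a \<in> carrier A \<Longrightarrow> b \<in> carrier A \<Longrightarrow> x \<in> carrier G \<Longrightarrow>
        H #>\<^bsub>G\<^esub> r x (a \<otimes>\<^bsub>A\<^esub> b) = H #>\<^bsub>G\<^esub> (r (r x a) b)"
    and lr: "\<And>a b x. a \<in> carrier A \<Longrightarrow> b \<in> carrier A \<Longrightarrow> x \<in> carrier G \<Longrightarrow>
        H #>\<^bsub>G\<^esub> l a (r x b) = H #>\<^bsub>G\<^esub> (r (l a x) b)"
    and ls: "\<And>k a x. k \<in> carrier K \<Longrightarrow> a \<in> carrier A \<Longrightarrow> x \<in> carrier G \<Longrightarrow>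
        H #>\<^bsub>G\<^esub> l (k \<odot>\<^bsub>A\<^esub> a) x = H #>\<^bsub>G\<^esub> s k (l a x)"
    and rs: "\<And>k a x. k \<in> carrier K \<Longrightarrow> a \<in> carrier A \<Longrightarrow> x \<in> carrier G \<Longrightarrow>
        H #>\<^bsub>G\<^esub> r x (k \<odot>\<^bsub>A\<^esub> a) = H #>\<^bsub>G\<^esub> s k (r x a)"
  shows "bimodule K A
    \<lparr>carrier = rcosets\<^bsub>G\<^esub> H, mult = u, one = v, ring.zero = H, add = set_mult G,
     smult = (\<lambda>k. coset_map G H (s k)), lact = (\<lambda>a. coset_map G H (l a)),
     ract = (\<lambda>C a. coset_map G H (\<lambda>n. r n a) C)\<rparr>" (is "bimodule K A ?Q")
proof -
  interpret A: assoc_algebra K A by fact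
  interpret G: comm_group G by fact
  interpret N: normal H G using G.normal_iff_subgroup H by blast
  interpret F: comm_group "G Mod H" by (rule G.abelian_FactGroup[OF H])
  have F: "carrier (G Mod H) = rcosets\<^bsub>G\<^esub> H" "\<one>\<^bsub>G Mod H\<^esub> = H" "monoid.mult (G Mod H) = set_mult G"
    by (simp_all add: FactGroup_def)
  have Q: "abelian_group ?Q"
    using F.m_closed F.one_closed F.m_assoc F.m_comm F.l_one F.l_inv_ex
    by (intro abelian_groupI) (simp_all add: F)
  have cl[simp]: "k \<in> carrier K \<Longrightarrow> x \<in> carrier G \<Longrightarrow> s k x \<in> carrier G"
    "a \<in> carrier A \<Longrightarrow> x \<in> carrier G \<Longrightarrow> l a x \<in> carrier G"
    "a \<in> carrier A \<Longrightarrow> x \<in> carrier G \<Longrightarrow> r x a \<in> carrier G" for k a x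
    using s[of k] l[of a] r[of a] by (auto simp: hom_def)
  have hom: "k \<in> carrier K \<Longrightarrow> x \<in> carrier G \<Longrightarrow> y \<in> carrier G \<Longrightarrow> s k (x \<otimes>\<^bsub>G\<^esub> y) = s k x \<otimes>\<^bsub>G\<^esub> s k y"
    "a \<in> carrier A \<Longrightarrow> x \<in> carrier G \<Longrightarrow> y \<in> carrier G \<Longrightarrow> l a (x \<otimes>\<^bsub>G\<^esub> y) = l a x \<otimes>\<^bsub>G\<^esub> l a y"
    "a \<in> carrier A \<Longrightarrow> x \<in> carrier G \<Longrightarrow> y \<in> carrier G \<Longrightarrow> r (x \<otimes>\<^bsub>G\<^esub> y) a = r x a \<otimes>\<^bsub>G\<^esub> r y a" for k a x y
    using s[of k] l[of a] r[of a] by (auto simp: hom_def)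
  have cm: "k \<in> carrier K \<Longrightarrow> x \<in> carrier G \<Longrightarrow> coset_map G H (s k) (H #>\<^bsub>G\<^esub> x) = H #>\<^bsub>G\<^esub> s k x"
    "a \<in> carrier A \<Longrightarrow> x \<in> carrier G \<Longrightarrow> coset_map G H (l a) (H #>\<^bsub>G\<^esub> x) = H #>\<^bsub>G\<^esub> l a x"
    "a \<in> carrier A \<Longrightarrow> x \<in> carrier G \<Longrightarrow> coset_map G H (\<lambda>n. r n a) (H #>\<^bsub>G\<^esub> x) = H #>\<^bsub>G\<^esub> r x a" for k a x
    using coset_map_r_coset[OF G H] s[of k] l[of a] r[of a] by auto
  have ex: "\<exists>x \<in> carrier G. C = H #>\<^bsub>G\<^esub> x" if "C \<in> rcosets\<^bsub>G\<^esub> H" for C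
    using that by (auto simp: RCOSETS_def)
  have rc: "x \<in> carrier G \<Longrightarrow> H #>\<^bsub>G\<^esub> x \<in> rcosets\<^bsub>G\<^esub> H" for x
    by (auto simp: RCOSETS_def)
  note sum = N.rcos_sum
  have Qm: "module K ?Q"
  proof (rule moduleI)
    show "cring K" by (rule A.R.is_cring)
    show "abelian_group ?Q" by (rule Q)
  qed (auto dest!: ex simp: cm sum rc sadd smul sone hom)
  show ?thesis
  proof (rule bimodule.intro[OF A Qm], unfold_locales)
  qed (auto dest!: ex simp: cm sum rc ladd radd lone rone lmul rmul lr ls rs hom)
qed

lemma (in bimodule) bimodule_quot_bimodule:
  assumes H: "subgroup H (add_monoid N)"
    and s: "\<And>k h. k \<in> carrier K \<Longrightarrow> h \<in> H \<Longrightarrow> k \<odot>\<^bsub>N\<^esub> h \<in> H"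
    and l: "\<And>a h. a \<in> carrier A \<Longrightarrow> h \<in> H \<Longrightarrow> lact N a h \<in> H"
    and r: "\<And>a h. a \<in> carrier A \<Longrightarrow> h \<in> H \<Longrightarrow> ract N h a \<in> H"
  shows "bimodule K A (quot_bimodule N H)"
  unfolding quot_bimodule_def A_RCOSETS_def set_add_def
proof (rule bimodule_quotient[OF A.assoc_algebra_axioms N.M.a_comm_group H])
qed (auto simp: hom_def s l r lact_closed ract_closed lact_add_left lact_add_right ract_add_left
  ract_add_right lact_one ract_one lact_mult ract_mult lact_ract lact_smult ract_smult
  N.smult_l_distr N.smult_r_distr N.smult_assoc1)

lemma bimodule_sum_bimodule:
  assumes M: "bimodule K A M" and N: "bimodule K A N"
  shows "bimodule K A (sum_bimodule M N)"
proof -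
  interpret M: bimodule K A M by fact
  interpret N: bimodule K A N by fact
  have S: "abelian_group (sum_bimodule M N)"
  proof (rule abelian_groupI)
    fix x assume x: "x \<in> carrier (sum_bimodule M N)"
    then show "\<exists>y\<in>carrier (sum_bimodule M N). y \<oplus>\<^bsub>sum_bimodule M N\<^esub> x = \<zero>\<^bsub>sum_bimodule M N\<^esub>"
      by (intro bexI[of _ "(\<ominus>\<^bsub>M\<^esub> fst x, \<ominus>\<^bsub>N\<^esub> snd x)"])
         (auto simp: sum_bimodule_def M.N.l_neg N.N.l_neg)
  qed (auto simp: sum_bimodule_def M.N.a_ac N.N.a_ac)
  have Sm: "module K (sum_bimodule M N)"
  proof (rule moduleI[OF M.A.R.is_cring S])
  qed (auto simp: sum_bimodule_def M.N.smult_l_distr N.N.smult_l_distr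
    M.N.smult_r_distr N.N.smult_r_distr M.N.smult_assoc1 N.N.smult_assoc1)
  show ?thesis
    by (rule bimodule.intro[OF M.A.assoc_algebra_axioms Sm], unfold_locales)
      (auto simp: sum_bimodule_def M.lact_closed M.ract_closed M.lact_add_left M.lact_add_right
        M.ract_add_left M.ract_add_right M.lact_one M.ract_one M.lact_mult M.ract_mult
        M.lact_ract M.lact_smult M.ract_smult N.lact_closed N.ract_closed N.lact_add_left
        N.lact_add_right N.ract_add_left N.ract_add_right N.lact_one N.ract_one N.lact_mult
        N.ract_mult N.lact_ract N.lact_smult N.ract_smult)
qed

lemma frag_extend_closed:
  assumes "\<And>x. x \<in> S \<Longrightarrow> f x \<in> carrier (free_Abelian_group T)"
  shows "frag_extend f \<in> hom (free_Abelian_group S) (free_Abelian_group T)"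
proof -
  have "Poly_Mapping.keys (frag_extend f c) \<subseteq> T" if "Poly_Mapping.keys c \<subseteq> S" for c
    using keys_frag_extend[of f c] assms that by fastforce
  then show ?thesis by (auto simp: hom_def frag_extend_add)
qed

lemma hom_generate_subset:
  assumes "group G" and "f \<in> hom G G" and R: "R \<subseteq> carrier G" and f: "f ` R \<subseteq> generate G R"
  shows "f ` generate G R \<subseteq> generate G R"
proof -
  interpret group_hom G G f using assms(1,2) by (simp add: group_hom_def group_hom_axioms_def)
  have "f x \<in> generate G R" if "x \<in> generate G R" for x
    using that
  proof (induction x rule: generate.induct)
    case (inv h)
    then show ?case using R f G.generate_m_inv_closed[OF R] by (auto simp: subset_iff)
  next
    case (eng h1 h2)
    then show ?case using G.generate_in_carrier[OF R] by (auto intro: generate.eng)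
  qed (use f in \<open>auto intro: generate.one\<close>)
  then show ?thesis by blast
qed

context assoc_algebra
begin

lemma tensor_relations_carrier: "tensor_relations K A A \<subseteq> carrier (pair_group A A)"
  unfolding tensor_relations_def
  by (auto simp: keys_frag_of intro!: order_trans[OF keys_diff] dest!: subsetD[OF keys_diff])

lemma subgroup_tensor_kernel: "subgroup (tensor_kernel K A A) (pair_group A A)"
  unfolding tensor_kernel_def
  by (rule group.generate_is_subgroup[OF group_free_Abelian_group tensor_relations_carrier])

lemma tensor_kernel_relation: "c \<in> tensor_relations K A A \<Longrightarrow> c \<in> tensor_kernel K A A"
  unfolding tensor_kernel_def by (rule generate.incl)

lemma tensor_kernel_0: "0 \<in> tensor_kernel K A A"
  using subgroup.one_closed[OF subgroup_tensor_kernel] by simp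

lemma tensor_kernel_carrier: "c \<in> tensor_kernel K A A \<Longrightarrow> Poly_Mapping.keys c \<subseteq> carrier A \<times> carrier A"
  using subgroup.subset[OF subgroup_tensor_kernel] by fastforce

lemma tensor_kernel_add:
  "c \<in> tensor_kernel K A A \<Longrightarrow> d \<in> tensor_kernel K A A \<Longrightarrow> c + d \<in> tensor_kernel K A A"
  using subgroup.m_closed[OF subgroup_tensor_kernel] by simp

lemma tensor_kernel_diff:
  "c \<in> tensor_kernel K A A \<Longrightarrow> d \<in> tensor_kernel K A A \<Longrightarrow> c - d \<in> tensor_kernel K A A"
  using subgroup.m_closed[OF subgroup_tensor_kernel, of c "- d"]
    subgroup.m_inv_closed[OF subgroup_tensor_kernel, of d] tensor_kernel_carrier[of d] by simp

lemma tensor_coset_eqI: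
  assumes "Poly_Mapping.keys c \<subseteq> carrier A \<times> carrier A" and d: "c - d \<in> tensor_kernel K A A"
  shows "tensor_kernel K A A #>\<^bsub>pair_group A A\<^esub> c = tensor_kernel K A A #>\<^bsub>pair_group A A\<^esub> d"
proof -
  have "\<exists>h\<in>tensor_kernel K A A. h' + c = h + d" if "h' \<in> tensor_kernel K A A" for h'
    using tensor_kernel_add[OF that d] by (intro bexI[of _ "h' + (c - d)"]) auto
  moreover have "\<exists>h\<in>tensor_kernel K A A. h' + d = h + c" if "h' \<in> tensor_kernel K A A" for h'
    using tensor_kernel_diff[OF that d] by (intro bexI[of _ "h' - (c - d)"]) auto
  ultimately show ?thesis by (fastforce simp: r_coset_def)
qed

lemma frag_extend_pair_hom:
  assumes "f \<in> carrier A \<rightarrow> carrier A" and "g \<in> carrier A \<rightarrow> carrier A"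
  shows "frag_extend (\<lambda>(x, y). frag_of (f x, g y)) \<in> hom (pair_group A A) (pair_group A A)"
  by (rule frag_extend_closed) (use assms in auto)

text \<open>Well-definedness of \<^const>\<open>tensor_map\<close> on linear maps.\<close>

lemma tensor_map_kernel:
  assumes f: "f \<in> carrier A \<rightarrow> carrier A" and g: "g \<in> carrier A \<rightarrow> carrier A"
    and fa: "\<And>x y. x \<in> carrier A \<Longrightarrow> y \<in> carrier A \<Longrightarrow> f (x \<oplus>\<^bsub>A\<^esub> y) = f x \<oplus>\<^bsub>A\<^esub> f y"
    and ga: "\<And>x y. x \<in> carrier A \<Longrightarrow> y \<in> carrier A \<Longrightarrow> g (x \<oplus>\<^bsub>A\<^esub> y) = g x \<oplus>\<^bsub>A\<^esub> g y"
    and fk: "\<And>k x. k \<in> carrier K \<Longrightarrow> x \<in> carrier A \<Longrightarrow> f (k \<odot>\<^bsub>A\<^esub> x) = k \<odot>\<^bsub>A\<^esub> f x"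
    and gk: "\<And>k x. k \<in> carrier K \<Longrightarrow> x \<in> carrier A \<Longrightarrow> g (k \<odot>\<^bsub>A\<^esub> x) = k \<odot>\<^bsub>A\<^esub> g x"
  shows "frag_extend (\<lambda>(x, y). frag_of (f x, g y)) ` tensor_kernel K A A \<subseteq> tensor_kernel K A A"
  unfolding tensor_kernel_def
proof (rule hom_generate_subset[OF group_free_Abelian_group frag_extend_pair_hom[OF f g] tensor_relations_carrier])
  have "frag_extend (\<lambda>(x, y). frag_of (f x, g y)) ` tensor_relations K A A \<subseteq> tensor_relations K A A"
    unfolding tensor_relations_def image_Un
    apply (intro Un_mono)
      apply (clarsimp simp: frag_extend_diff fa)
    using f g apply blast
     apply (clarsimp simp: frag_extend_diff ga)
    using f g apply blast
    apply (clarsimp simp: frag_extend_diff fk gk)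
    using f g apply blast
    done
  then show "frag_extend (\<lambda>(x, y). frag_of (f x, g y)) ` tensor_relations K A A
      \<subseteq> generate (pair_group A A) (tensor_relations K A A)"
    by (auto intro: generate.incl)
qed

lemma frag_extend_pair_compose:
  "frag_extend (\<lambda>(x, y). frag_of (f x, g y)) (frag_extend (\<lambda>(x, y). frag_of (f' x, g' y)) c) =
    frag_extend (\<lambda>(x, y). frag_of (f (f' x), g (g' y))) c"
  using frag_extend_compose[of "\<lambda>(x, y). frag_of (f x, g y)" "\<lambda>(x, y). (f' x, g' y)" c]
  by (simp add: comp_def case_prod_unfold)

lemma frag_extend_pair_id:
  "frag_extend (\<lambda>(x, y). frag_of (x, y)) c = c"
  using frag_expansion[of c] by (simp add: case_prod_unfold)

lemma frag_extend_pair_cong: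
  assumes "Poly_Mapping.keys c \<subseteq> carrier A \<times> carrier A"
    and "\<And>x y. x \<in> carrier A \<Longrightarrow> y \<in> carrier A \<Longrightarrow> frag_of (f x, g y) = frag_of (f' x, g' y)"
  shows "frag_extend (\<lambda>(x, y). frag_of (f x, g y)) c = frag_extend (\<lambda>(x, y). frag_of (f' x, g' y)) c"
  by (rule frag_extend_eq) (use assms in auto)

lemma frag_extend_mod:
  assumes c: "Poly_Mapping.keys c \<subseteq> carrier A \<times> carrier A"
    and "\<And>x y. x \<in> carrier A \<Longrightarrow> y \<in> carrier A \<Longrightarrow> p (x, y) - q (x, y) \<in> tensor_kernel K A A"
  shows "frag_extend p c - frag_extend q c \<in> tensor_kernel K A A"
  using c
proof (induction c rule: frag_induction)
  case (diff a b)
  have "frag_extend p (a - b) - frag_extend q (a - b) =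
    (frag_extend p a - frag_extend q a) - (frag_extend p b - frag_extend q b)"
    by (simp add: frag_extend_diff)
  with diff show ?case by (simp add: tensor_kernel_diff)
qed (use assms in \<open>auto simp: tensor_kernel_0\<close>)

lemma frag_extend_plus:
  "frag_extend (\<lambda>x. p x + q x) c = frag_extend p c + frag_extend q c"
  by (simp add: frag_extend_def frag_cmul_distrib2 sum.distrib)

lemma bimodule_tensor_square: "bimodule K A (tensor_square K A)"
proof -
  let ?F = "pair_group A A" and ?T = "tensor_kernel K A A"
  let ?e = "\<lambda>f g. frag_extend (\<lambda>(x, y). frag_of (f x, g y))"
  have eqI: "?T #>\<^bsub>?F\<^esub> ?e f g c = ?T #>\<^bsub>?F\<^esub> (?e f' g' c \<otimes>\<^bsub>?F\<^esub> ?e f'' g'' c)"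
    if "c \<in> carrier ?F" "f \<in> carrier A \<rightarrow> carrier A" "g \<in> carrier A \<rightarrow> carrier A"
      "\<And>x y. x \<in> carrier A \<Longrightarrow> y \<in> carrier A \<Longrightarrow>
        frag_of (f x, g y) - frag_of (f' x, g' y) - frag_of (f'' x, g'' y) \<in> tensor_relations K A A"
    for c f g f' g' f'' g''
  proof (rule tensor_coset_eqI)
    show "Poly_Mapping.keys (?e f g c) \<subseteq> carrier A \<times> carrier A"
      using hom_in_carrier[OF frag_extend_pair_hom[OF that(2,3)] that(1)] by simp
    have "?e f g c - frag_extend (\<lambda>z. (case z of (x, y) \<Rightarrow> frag_of (f' x, g' y)) +
        (case z of (x, y) \<Rightarrow> frag_of (f'' x, g'' y))) c \<in> ?T"
      by (rule frag_extend_mod)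
         (use that tensor_kernel_relation in \<open>auto simp: diff_diff_eq\<close>)
    then show "?e f g c - (?e f' g' c \<otimes>\<^bsub>?F\<^esub> ?e f'' g'' c) \<in> ?T"
      by (simp add: frag_extend_plus)
  qed
  have bal: "?T #>\<^bsub>?F\<^esub> ?e f g c = ?T #>\<^bsub>?F\<^esub> ?e f' g' c"
    if "c \<in> carrier ?F" "f \<in> carrier A \<rightarrow> carrier A" "g \<in> carrier A \<rightarrow> carrier A"
      "\<And>x y. x \<in> carrier A \<Longrightarrow> y \<in> carrier A \<Longrightarrow>
        frag_of (f x, g y) - frag_of (f' x, g' y) \<in> ?T"
    for c f g f' g'
  proof (rule tensor_coset_eqI)
    show "Poly_Mapping.keys (?e f g c) \<subseteq> carrier A \<times> carrier A"
      using hom_in_carrier[OF frag_extend_pair_hom[OF that(2,3)] that(1)] by simp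
    show "?e f g c - ?e f' g' c \<in> ?T"
      by (rule frag_extend_mod) (use that in auto)
  qed
  have neg: "- u \<in> ?T" if "u \<in> ?T" for u using tensor_kernel_diff[OF tensor_kernel_0 that] by simp
  have swap: "frag_of (x, k \<odot>\<^bsub>A\<^esub> y) - frag_of (k \<odot>\<^bsub>A\<^esub> x, y) \<in> ?T"
    if "k \<in> carrier K" "x \<in> carrier A" "y \<in> carrier A" for k x y
  proof -
    have "frag_of (k \<odot>\<^bsub>A\<^esub> x, y) - frag_of (x, k \<odot>\<^bsub>A\<^esub> y) \<in> ?T"
      by (rule tensor_kernel_relation) (use that in \<open>unfold tensor_relations_def, blast\<close>)
    from neg[OF this] show ?thesis by simp
  qed
  show ?thesis
    unfolding tensor_square_def tensor_map_def
  proof (rule bimodule_quotient[where s = "\<lambda>k. ?e (\<lambda>a. k \<odot>\<^bsub>A\<^esub> a) (\<lambda>b. b)"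
        and l = "\<lambda>x. ?e (\<lambda>a. x \<otimes>\<^bsub>A\<^esub> a) (\<lambda>b. b)"
        and r = "\<lambda>t y. ?e (\<lambda>a. a) (\<lambda>b. b \<otimes>\<^bsub>A\<^esub> y) t",
        OF assoc_algebra_axioms abelian_free_Abelian_group subgroup_tensor_kernel], goal_cases)
    case (1 k)
    then show ?case
      by (intro conjI frag_extend_pair_hom tensor_map_kernel)
         (auto simp: smult_r_distr smult_assoc1[symmetric] R.m_comm)
  next
    case (2 a)
    then show ?case
      by (intro conjI frag_extend_pair_hom tensor_map_kernel)
         (auto simp: r_distr smult_mult_right)
  next
    case (3 a)
    then show ?case
      by (intro conjI frag_extend_pair_hom tensor_map_kernel)
         (auto simp: l_distr smult_mult_left)
  next
    case (4 k k' x)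
    then show ?case
    proof (intro eqI)
      fix u v assume "u \<in> carrier A" "v \<in> carrier A"
      with 4(1,2) show "frag_of ((k \<oplus>\<^bsub>K\<^esub> k') \<odot>\<^bsub>A\<^esub> u, v) - frag_of (k \<odot>\<^bsub>A\<^esub> u, v) - frag_of (k' \<odot>\<^bsub>A\<^esub> u, v) \<in> tensor_relations K A A"
        by (simp only: smult_l_distr) (unfold tensor_relations_def, blast intro: smult_closed m_closed)
    qed auto
  next
    case (5 k k' x)
    then show ?case
      unfolding frag_extend_pair_compose
      by (intro arg_cong[where f = "r_coset _ _"] frag_extend_pair_cong) (auto simp: smult_assoc1)
  next
    case (6 x)
    then have "frag_extend (\<lambda>(x, y). frag_of (\<one>\<^bsub>K\<^esub> \<odot>\<^bsub>A\<^esub> x, y)) x = frag_extend (\<lambda>(x, y). frag_of (x, y)) x"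
      by (intro frag_extend_pair_cong) auto
    then show ?case by (simp add: frag_extend_pair_id)
  next
    case (7 a b x)
    then show ?case
    proof (intro eqI)
      fix u v assume "u \<in> carrier A" "v \<in> carrier A"
      with 7(1,2) show "frag_of ((a \<oplus>\<^bsub>A\<^esub> b) \<otimes>\<^bsub>A\<^esub> u, v) - frag_of (a \<otimes>\<^bsub>A\<^esub> u, v) - frag_of (b \<otimes>\<^bsub>A\<^esub> u, v) \<in> tensor_relations K A A"
        by (simp only: l_distr) (unfold tensor_relations_def, blast intro: smult_closed m_closed)
    qed auto
  next
    case (8 a b x)
    then show ?case
    proof (intro eqI)
      fix u v assume "u \<in> carrier A" "v \<in> carrier A"
      with 8(1,2) show "frag_of (u, v \<otimes>\<^bsub>A\<^esub> (a \<oplus>\<^bsub>A\<^esub> b)) - frag_of (u, v \<otimes>\<^bsub>A\<^esub> a) - frag_of (u, v \<otimes>\<^bsub>A\<^esub> b) \<in> tensor_relations K A A"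
        by (simp only: r_distr) (unfold tensor_relations_def, blast intro: smult_closed m_closed)
    qed auto
  next
    case (9 x)
    then have "frag_extend (\<lambda>(x, y). frag_of (\<one>\<^bsub>A\<^esub> \<otimes>\<^bsub>A\<^esub> x, y)) x = frag_extend (\<lambda>(x, y). frag_of (x, y)) x"
      by (intro frag_extend_pair_cong) auto
    then show ?case by (simp add: frag_extend_pair_id)
  next
    case (10 x)
    then have "frag_extend (\<lambda>(x, y). frag_of (x, y \<otimes>\<^bsub>A\<^esub> \<one>\<^bsub>A\<^esub>)) x = frag_extend (\<lambda>(x, y). frag_of (x, y)) x"
      by (intro frag_extend_pair_cong) auto
    then show ?case by (simp add: frag_extend_pair_id)
  next
    case (11 a b x)
    then show ?case
      unfolding frag_extend_pair_compose
      by (intro arg_cong[where f = "r_coset _ _"] frag_extend_pair_cong) (auto simp: m_assoc)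
  next
    case (12 a b x)
    then show ?case
      unfolding frag_extend_pair_compose
      by (intro arg_cong[where f = "r_coset _ _"] frag_extend_pair_cong) (auto simp: m_assoc)
  next
    case (13 a b x)
    then show ?case unfolding frag_extend_pair_compose by simp
  next
    case (14 k a x)
    then show ?case
      unfolding frag_extend_pair_compose
      by (intro arg_cong[where f = "r_coset _ _"] frag_extend_pair_cong) (auto simp: smult_mult_left)
  next
    case (15 k a x)
    then show ?case
      unfolding frag_extend_pair_compose
      by (intro bal) (auto simp: smult_mult_right swap)
  qed
qed


lemma pure_tensor_closed:
  "x \<in> carrier A \<Longrightarrow> y \<in> carrier A \<Longrightarrow> pure_tensor K A A x y \<in> carrier (tensor_square K A)"
  by (auto simp: pure_tensor_def tensor_square_def RCOSETS_def)

lemma tensor_map_pure_tensor: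
  assumes "f \<in> carrier A \<rightarrow> carrier A" and "g \<in> carrier A \<rightarrow> carrier A"
    and "frag_extend (\<lambda>(x, y). frag_of (f x, g y)) ` tensor_kernel K A A \<subseteq> tensor_kernel K A A"
    and "x \<in> carrier A" and "y \<in> carrier A"
  shows "tensor_map K A A f g (pure_tensor K A A x y) = pure_tensor K A A (f x) (g y)"
  unfolding tensor_map_def pure_tensor_def
  using coset_map_r_coset[OF abelian_free_Abelian_group subgroup_tensor_kernel
      frag_extend_pair_hom[OF assms(1,2)] assms(3), of "frag_of (x, y)"] assms(4,5)
  by simp

lemma lact_pure_tensor:
  assumes "a \<in> carrier A" "x \<in> carrier A" "y \<in> carrier A"
  shows "lact (tensor_square K A) a (pure_tensor K A A x y) = pure_tensor K A A (a \<otimes>\<^bsub>A\<^esub> x) y"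
proof -
  have "tensor_map K A A (\<lambda>x. a \<otimes>\<^bsub>A\<^esub> x) (\<lambda>y. y) (pure_tensor K A A x y) = pure_tensor K A A ((\<lambda>x. a \<otimes>\<^bsub>A\<^esub> x) x) ((\<lambda>y. y) y)"
    by (intro tensor_map_pure_tensor tensor_map_kernel) (use assms in \<open>auto simp: r_distr smult_mult_right\<close>)
  then show ?thesis by (simp add: tensor_square_def)
qed

lemma ract_pure_tensor:
  assumes "a \<in> carrier A" "x \<in> carrier A" "y \<in> carrier A"
  shows "ract (tensor_square K A) (pure_tensor K A A x y) a = pure_tensor K A A x (y \<otimes>\<^bsub>A\<^esub> a)"
proof -
  have "tensor_map K A A (\<lambda>x. x) (\<lambda>y. y \<otimes>\<^bsub>A\<^esub> a) (pure_tensor K A A x y) = pure_tensor K A A ((\<lambda>x. x) x) ((\<lambda>y. y \<otimes>\<^bsub>A\<^esub> a) y)"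
    by (intro tensor_map_pure_tensor tensor_map_kernel) (use assms in \<open>auto simp: l_distr smult_mult_left\<close>)
  then show ?thesis by (simp add: tensor_square_def)
qed

end

lemma (in bimodule) lact_minus:
  assumes "a \<in> carrier A" "n \<in> carrier N" "n' \<in> carrier N"
  shows "lact N a (n \<ominus>\<^bsub>N\<^esub> n') = lact N a n \<ominus>\<^bsub>N\<^esub> lact N a n'"
proof -
  have "lact N a (n \<ominus>\<^bsub>N\<^esub> n') \<oplus>\<^bsub>N\<^esub> lact N a n' = lact N a n"
    using assms by (simp add: lact_add_right[symmetric] N.M.minus_eq N.M.a_assoc N.M.l_neg)
  then show ?thesis
    using assms by (metis N.M.add.inv_solve_right N.M.minus_closed N.M.minus_eq lact_closed)
qed

lemma (in bimodule) ract_minus: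
  assumes "a \<in> carrier A" "n \<in> carrier N" "n' \<in> carrier N"
  shows "ract N (n \<ominus>\<^bsub>N\<^esub> n') a = ract N n a \<ominus>\<^bsub>N\<^esub> ract N n' a"
proof -
  have "ract N (n \<ominus>\<^bsub>N\<^esub> n') a \<oplus>\<^bsub>N\<^esub> ract N n' a = ract N n a"
    using assms by (simp add: ract_add_left[symmetric] N.M.minus_eq N.M.a_assoc N.M.l_neg)
  then show ?thesis
    using assms by (metis N.M.add.inv_solve_right N.M.minus_closed N.M.minus_eq ract_closed)
qed

context derivation
begin

abbreviation "derivation_sum \<equiv> sum_bimodule (tensor_square K A) M"
abbreviation "derivation_kernel \<equiv> generate (add_monoid derivation_sum) (derivation_relations K A M D)"

sublocale T: bimodule K A "tensor_square K A" by (rule A.bimodule_tensor_square)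
sublocale S: bimodule K A derivation_sum
  by (rule bimodule_sum_bimodule[OF T.bimodule_axioms bimodule_axioms])

lemma derivation_relations_carrier: "derivation_relations K A M D \<subseteq> carrier derivation_sum"
  unfolding derivation_relations_def
  by (clarsimp simp: sum_bimodule_def A.pure_tensor_closed D_closed ract_closed)

lemma derivation_kernel_closed:
  assumes hom: "f \<in> hom (add_monoid derivation_sum) (add_monoid derivation_sum)"
    and rel: "\<And>a b. a \<in> carrier A \<Longrightarrow> b \<in> carrier A \<Longrightarrow>
      f (pure_tensor K A A a b \<ominus>\<^bsub>tensor_square K A\<^esub> pure_tensor K A A \<one>\<^bsub>A\<^esub> (a \<otimes>\<^bsub>A\<^esub> b), ract M (D a) b)
        \<in> derivation_kernel"
    and h: "h \<in> derivation_kernel"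
  shows "f h \<in> derivation_kernel"
proof -
  have im: "f ` derivation_relations K A M D \<subseteq> derivation_kernel"
  proof (rule image_subsetI)
    fix z assume "z \<in> derivation_relations K A M D"
    then obtain a b where "a \<in> carrier A" "b \<in> carrier A"
      "z = (pure_tensor K A A a b \<ominus>\<^bsub>tensor_square K A\<^esub> pure_tensor K A A \<one>\<^bsub>A\<^esub> (a \<otimes>\<^bsub>A\<^esub> b), ract M (D a) b)"
      unfolding derivation_relations_def by blast
    then show "f z \<in> derivation_kernel" using rel by simp
  qed
  have "derivation_relations K A M D \<subseteq> carrier (add_monoid derivation_sum)"
    using derivation_relations_carrier by simp
  from hom_generate_subset[OF S.N.M.a_group hom this im] h show ?thesis by blast
qed

lemma derivation_kernel_rel:
  "a \<in> carrier A \<Longrightarrow> b \<in> carrier A \<Longrightarrow>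
    (pure_tensor K A A a b \<ominus>\<^bsub>tensor_square K A\<^esub> pure_tensor K A A \<one>\<^bsub>A\<^esub> (a \<otimes>\<^bsub>A\<^esub> b), ract M (D a) b)
      \<in> derivation_kernel"
  by (rule generate.incl, subst derivation_relations_def, blast)

lemma derivation_kernel_subgroup: "subgroup derivation_kernel (add_monoid derivation_sum)"
  by (rule group.generate_is_subgroup[OF S.N.M.a_group]) (use derivation_relations_carrier in simp)

lemma derivation_kernel_lact:
  assumes c: "c \<in> carrier A" and h: "h \<in> derivation_kernel"
  shows "lact derivation_sum c h \<in> derivation_kernel"
proof (rule derivation_kernel_closed[OF _ _ h])
  show "lact derivation_sum c \<in> hom (add_monoid derivation_sum) (add_monoid derivation_sum)"
    using c by (auto simp: hom_def S.lact_closed S.lact_add_right)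
next
  fix a b assume ab: "a \<in> carrier A" "b \<in> carrier A"
  let ?p = "pure_tensor K A A" and ?T = "tensor_square K A"
  let ?r = "\<lambda>a b. (?p a b \<ominus>\<^bsub>?T\<^esub> ?p \<one>\<^bsub>A\<^esub> (a \<otimes>\<^bsub>A\<^esub> b), ract M (D a) b)"
  have m: "lact M c (ract M (D a) b) \<oplus>\<^bsub>M\<^esub> ract M (D c) (a \<otimes>\<^bsub>A\<^esub> b) = ract M (D (c \<otimes>\<^bsub>A\<^esub> a)) b"
    using ab c by (simp add: D_mult D_closed lact_closed ract_closed lact_ract ract_mult ract_add_left)
  have t: "(?p (c \<otimes>\<^bsub>A\<^esub> a) b \<ominus>\<^bsub>?T\<^esub> ?p c (a \<otimes>\<^bsub>A\<^esub> b)) \<oplus>\<^bsub>?T\<^esub>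
      (?p c (a \<otimes>\<^bsub>A\<^esub> b) \<ominus>\<^bsub>?T\<^esub> ?p \<one>\<^bsub>A\<^esub> (c \<otimes>\<^bsub>A\<^esub> (a \<otimes>\<^bsub>A\<^esub> b))) =
      ?p (c \<otimes>\<^bsub>A\<^esub> a) b \<ominus>\<^bsub>?T\<^esub> ?p \<one>\<^bsub>A\<^esub> (c \<otimes>\<^bsub>A\<^esub> (a \<otimes>\<^bsub>A\<^esub> b))"
    using ab c by (simp add: T.N.M.minus_eq T.N.M.a_assoc A.pure_tensor_closed T.N.M.r_neg1)
  have l: "lact derivation_sum c (?r a b) =
      (?p (c \<otimes>\<^bsub>A\<^esub> a) b \<ominus>\<^bsub>?T\<^esub> ?p c (a \<otimes>\<^bsub>A\<^esub> b), lact M c (ract M (D a) b))"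
    using ab c by (simp add: sum_bimodule_def T.lact_minus A.pure_tensor_closed A.lact_pure_tensor)
  have eq: "lact derivation_sum c (?r a b) \<oplus>\<^bsub>derivation_sum\<^esub> ?r c (a \<otimes>\<^bsub>A\<^esub> b) = ?r (c \<otimes>\<^bsub>A\<^esub> a) b"
    unfolding l using ab c t m by (simp add: sum_bimodule_def A.m_assoc)
  have car: "?r a b \<in> carrier derivation_sum" if "a \<in> carrier A" "b \<in> carrier A" for a b
    using that by (auto simp: sum_bimodule_def A.pure_tensor_closed D_closed ract_closed)
  have "lact derivation_sum c (?r a b) = ?r (c \<otimes>\<^bsub>A\<^esub> a) b \<oplus>\<^bsub>derivation_sum\<^esub> \<ominus>\<^bsub>derivation_sum\<^esub> ?r c (a \<otimes>\<^bsub>A\<^esub> b)"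
    unfolding eq[symmetric] using car ab c S.lact_closed[OF c car[OF ab]]
    by (simp add: S.N.M.a_assoc S.N.M.r_neg)
  also have "\<dots> \<in> derivation_kernel"
    using ab c derivation_kernel_rel[of "c \<otimes>\<^bsub>A\<^esub> a" b] derivation_kernel_rel[of c "a \<otimes>\<^bsub>A\<^esub> b"]
      subgroup.m_closed[OF derivation_kernel_subgroup] subgroup.m_inv_closed[OF derivation_kernel_subgroup]
    by (simp add: a_inv_def)
  finally show "lact derivation_sum c (?r a b) \<in> derivation_kernel" .
qed

lemma derivation_kernel_ract:
  assumes c: "c \<in> carrier A" and h: "h \<in> derivation_kernel"
  shows "ract derivation_sum h c \<in> derivation_kernel"
proof (rule derivation_kernel_closed[OF _ _ h])
  show "(\<lambda>h. ract derivation_sum h c) \<in> hom (add_monoid derivation_sum) (add_monoid derivation_sum)"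
    using c by (auto simp: hom_def S.ract_closed S.ract_add_left)
next
  fix a b assume ab: "a \<in> carrier A" "b \<in> carrier A"
  let ?p = "pure_tensor K A A" and ?T = "tensor_square K A"
  let ?r = "\<lambda>a b. (?p a b \<ominus>\<^bsub>?T\<^esub> ?p \<one>\<^bsub>A\<^esub> (a \<otimes>\<^bsub>A\<^esub> b), ract M (D a) b)"
  have "ract derivation_sum (?r a b) c = ?r a (b \<otimes>\<^bsub>A\<^esub> c)"
    using ab c by (simp add: sum_bimodule_def T.ract_minus A.pure_tensor_closed A.ract_pure_tensor
        ract_mult D_closed A.m_assoc)
  then show "ract derivation_sum (?r a b) c \<in> derivation_kernel"
    using derivation_kernel_rel[of a "b \<otimes>\<^bsub>A\<^esub> c"] ab c by simp
qed

lemma derivation_kernel_smult: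
  assumes k: "k \<in> carrier K" and h: "h \<in> derivation_kernel"
  shows "k \<odot>\<^bsub>derivation_sum\<^esub> h \<in> derivation_kernel"
proof -
  have "h \<in> carrier derivation_sum" using subgroup.subset[OF derivation_kernel_subgroup] h by auto
  then have "lact derivation_sum (k \<odot>\<^bsub>A\<^esub> \<one>\<^bsub>A\<^esub>) h = k \<odot>\<^bsub>derivation_sum\<^esub> h"
    using k by (simp add: S.lact_smult S.lact_one)
  then show ?thesis
    using derivation_kernel_lact[OF _ h, of "k \<odot>\<^bsub>A\<^esub> \<one>\<^bsub>A\<^esub>"] k by simp
qed

text \<open>The subgroup generated by the relations is a sub-bimodule, and the quotient is a bimodule.\<close>

theorem bimodule_derivation_bimodule: "bimodule K A (derivation_bimodule K A M D)"
  unfolding derivation_bimodule_def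
  by (rule S.bimodule_quot_bimodule[OF derivation_kernel_subgroup
      derivation_kernel_smult derivation_kernel_lact derivation_kernel_ract])

end

end

(* By the relations, the class of (a \<otimes> b, m) equals that of (1 \<otimes> ab, m - D(a)b). Hence the difference
   between the left and right action of z on the class of 1 \<otimes> 1 is the class of (0, -D(z)), while
   (a \<otimes> b, m) \<mapsto> m - D(a)b descends to an additive retraction of M \<rightarrow> E_D. So M embeds in E_D, and
   an element that centralizes E_D centralizes M and is killed by D. Conversely, for z in Z_M(A) the
   elements of E_D commuting with z form a subgroup containing M, and if D(z) = 0 then it
   contains every a \<otimes> b. *)
theory Submission
  imports Defs
begin

section \<open>Bimodule identities and actions on cosets\<close>

text \<open>Both actions are additive, hence so is the commutator with \<open>z\<close>. It follows
  that the elements whose commutator with \<open>z\<close> lies in a given subgroup are closed under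
  subtraction.\<close>

lemma (in bimodule) commutator_minus:
  assumes "z \<in> carrier A" "x \<in> carrier N" "y \<in> carrier N"
  shows "lact N z (x \<ominus>\<^bsub>N\<^esub> y) \<ominus>\<^bsub>N\<^esub> ract N (x \<ominus>\<^bsub>N\<^esub> y) z =
    (lact N z x \<ominus>\<^bsub>N\<^esub> ract N x z) \<ominus>\<^bsub>N\<^esub> (lact N z y \<ominus>\<^bsub>N\<^esub> ract N y z)"
  using assms
  by (simp add: lact_minus ract_minus)
    (simp add: lact_closed ract_closed N.M.minus_eq N.M.minus_add N.M.a_ac)

lemma (in bimodule) lact_zero: "a \<in> carrier A \<Longrightarrow> lact N a \<zero>\<^bsub>N\<^esub> = \<zero>\<^bsub>N\<^esub>"
  using lact_add_right[of a "\<zero>\<^bsub>N\<^esub>" "\<zero>\<^bsub>N\<^esub>"] lact_closed[of a "\<zero>\<^bsub>N\<^esub>"] by simp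

lemma (in bimodule) ract_zero: "a \<in> carrier A \<Longrightarrow> ract N \<zero>\<^bsub>N\<^esub> a = \<zero>\<^bsub>N\<^esub>"
  using ract_add_left[of a "\<zero>\<^bsub>N\<^esub>" "\<zero>\<^bsub>N\<^esub>"] ract_closed[of a "\<zero>\<^bsub>N\<^esub>"] by simp

text \<open>The scalar \<open>k\<close> acts as right multiplication by \<open>k\<close> times the
  unit of \<open>A\<close>, and this factor is then absorbed into \<open>a\<close>. With this, D(a)b
  is seen to be balanced over \<open>K\<close>.\<close>

lemma (in bimodule) ract_smult_left:
  assumes "k \<in> carrier K" "a \<in> carrier A" "n \<in> carrier N"
  shows "ract N (k \<odot>\<^bsub>N\<^esub> n) a = k \<odot>\<^bsub>N\<^esub> ract N n a"
proof -
  have "ract N (k \<odot>\<^bsub>N\<^esub> n) a = ract N (ract N n (k \<odot>\<^bsub>A\<^esub> \<one>\<^bsub>A\<^esub>)) a"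
    using assms by (simp add: ract_smult ract_one)
  also have "\<dots> = ract N n (k \<odot>\<^bsub>A\<^esub> a)"
    using assms by (simp add: ract_mult[symmetric] A.smult_mult_left)
  finally show ?thesis using assms by (simp add: ract_smult)
qed

text \<open>Since \<open>H\<close> is stable under both actions of \<open>a\<close>, the actions on
  the quotient can be computed on representatives by \<open>coset_map_r_coset\<close>.\<close>

lemma (in bimodule) quot_actions_r_coset:
  assumes H: "subgroup H (add_monoid N)" and a: "a \<in> carrier A" and x: "x \<in> carrier N"
    and l: "\<And>h. h \<in> H \<Longrightarrow> lact N a h \<in> H"
    and r: "\<And>h. h \<in> H \<Longrightarrow> ract N h a \<in> H"
  shows "lact (quot_bimodule N H) a (H +>\<^bsub>N\<^esub> x) = H +>\<^bsub>N\<^esub> lact N a x"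
    and "ract (quot_bimodule N H) (H +>\<^bsub>N\<^esub> x) a = H +>\<^bsub>N\<^esub> ract N x a"
proof -
  have "lact N a \<in> hom (add_monoid N) (add_monoid N)"
    "(\<lambda>n. ract N n a) \<in> hom (add_monoid N) (add_monoid N)"
    using a by (auto simp: hom_def lact_closed ract_closed lact_add_right ract_add_left)
  with coset_map_r_coset[OF N.M.a_comm_group H] l r x
  show "lact (quot_bimodule N H) a (H +>\<^bsub>N\<^esub> x) = H +>\<^bsub>N\<^esub> lact N a x"
    and "ract (quot_bimodule N H) (H +>\<^bsub>N\<^esub> x) a = H +>\<^bsub>N\<^esub> ract N x a"
    by (auto simp: quot_bimodule_def a_r_coset_def image_subset_iff)
qed

section \<open>Differences and cosets in abelian groups\<close>

lemma (in abelian_group) a_inv_zero: "\<ominus> \<zero> = \<zero>"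
  using l_neg[of "\<zero>"] by simp

text \<open>This is the shape that the additivity relations of the tensor product take under a
  biadditive map.\<close>

lemma (in abelian_group) add_minus_minus_cancel:
  assumes "x \<in> carrier G" "y \<in> carrier G"
  shows "x \<oplus> y \<ominus> x \<ominus> y = \<zero>"
  using assms r_neg[of "x \<oplus> y"] by (simp add: minus_eq minus_add a_assoc)

text \<open>Serves to cancel the common term 1 \<otimes> zab in a difference of two defining
  relations of E_D.\<close>

lemma (in abelian_group) minus_minus_cancel_right:
  assumes "x \<in> carrier G" "y \<in> carrier G" "z \<in> carrier G"
  shows "(x \<ominus> z) \<ominus> (y \<ominus> z) = x \<ominus> y"
proof -
  have "(x \<ominus> z) \<ominus> (y \<ominus> z) = x \<oplus> (\<ominus> z \<oplus> (z \<oplus> \<ominus> y))"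
    using assms by (simp add: minus_eq minus_add a_assoc a_comm[of "\<ominus> y" z])
  then show ?thesis using assms by (simp add: minus_eq r_neg1)
qed

lemma (in abelian_group) a_r_coset_eq_iff:
  assumes H: "subgroup H (add_monoid G)" and x: "x \<in> carrier G" and y: "y \<in> carrier G"
  shows "H +> x = H +> y \<longleftrightarrow> x \<ominus> y \<in> H"
proof -
  have "H +> x = H +> y \<longleftrightarrow> x \<in> H +> y"
    using add.repr_independence[OF _ _ H] add.repr_independenceD[OF H] x y
    unfolding a_r_coset_def by auto
  also have "\<dots> \<longleftrightarrow> x \<ominus> y \<in> H"
    using subgroup.rcos_module[OF H a_group, of y x] x y
    by (simp add: a_r_coset_def a_minus_def a_inv_def)
  finally show ?thesis .
qed

text \<open>The kernel of a homomorphism is a subgroup, so it contains everything generated by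
  elements that it contains.\<close>

lemma (in abelian_group) generate_subset_kernel:
  assumes B: "abelian_group B" and f: "f \<in> hom (add_monoid G) (add_monoid B)"
    and R: "R \<subseteq> carrier G" and z: "\<And>r. r \<in> R \<Longrightarrow> f r = \<zero>\<^bsub>B\<^esub>"
    and x: "x \<in> generate (add_monoid G) R"
  shows "f x = \<zero>\<^bsub>B\<^esub>"
proof -
  interpret B: abelian_group B by fact
  interpret group_hom "add_monoid G" "add_monoid B" f
    by (simp add: group_hom_def group_hom_axioms_def a_group B.a_group f)
  have "R \<subseteq> kernel (add_monoid G) (add_monoid B) f" using R z by (auto simp: kernel_def)
  then have "generate (add_monoid G) R \<subseteq> kernel (add_monoid G) (add_monoid B) f"
    by (rule add.generate_subgroup_incl[OF _ subgroup_kernel])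
  with x show ?thesis by (auto simp: kernel_def)
qed

section \<open>The tensor square: induction and universal property\<close>

context assoc_algebra
begin

text \<open>Addition of cosets comes from addition of representatives, so the coset of
  \<open>c - d\<close> plus that of \<open>d\<close> is that of \<open>c\<close>; the claim follows
  by solving for the first summand.\<close>

lemma tensor_square_minus_r_coset:
  assumes "c \<in> carrier (pair_group A A)" "d \<in> carrier (pair_group A A)"
  shows "tensor_kernel K A A #>\<^bsub>pair_group A A\<^esub> (c - d) =
    (tensor_kernel K A A #>\<^bsub>pair_group A A\<^esub> c) \<ominus>\<^bsub>tensor_square K A\<^esub>
      (tensor_kernel K A A #>\<^bsub>pair_group A A\<^esub> d)"
proof -
  interpret T: bimodule K A "tensor_square K A" by (rule bimodule_tensor_square)
  interpret F: comm_group "pair_group A A" by (rule abelian_free_Abelian_group)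
  interpret N: normal "tensor_kernel K A A" "pair_group A A"
    using F.normal_iff_subgroup subgroup_tensor_kernel by blast
  let ?c = "\<lambda>c. tensor_kernel K A A #>\<^bsub>pair_group A A\<^esub> c"
  have cd: "c - d \<in> carrier (pair_group A A)"
    using assms keys_diff[of c d] by auto
  have cl: "?c e \<in> carrier (tensor_square K A)" if "e \<in> carrier (pair_group A A)" for e
    using that by (auto simp: tensor_square_def RCOSETS_def)
  have "?c (c - d) \<oplus>\<^bsub>tensor_square K A\<^esub> ?c d = ?c c"
    using N.rcos_sum[OF cd assms(2)] by (simp add: tensor_square_def)
  then show ?thesis
    using cl[OF cd] cl[OF assms(1)] cl[OF assms(2)]
    by (metis T.N.M.add.inv_solve_right T.N.M.minus_eq)
qed

text \<open>Every tensor is the coset of an integer combination of pairs, and such combinations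
  arise from zero and single pairs by subtraction. Differences rather than sums also cover the
  negative coefficients.\<close>

lemma tensor_square_induct [consumes 1, case_names zero pure_tensor minus]:
  assumes "t \<in> carrier (tensor_square K A)"
    and zero: "P \<zero>\<^bsub>tensor_square K A\<^esub>"
    and pure_tensor: "\<And>a b. a \<in> carrier A \<Longrightarrow> b \<in> carrier A \<Longrightarrow> P (pure_tensor K A A a b)"
    and minus: "\<And>s t. s \<in> carrier (tensor_square K A) \<Longrightarrow> t \<in> carrier (tensor_square K A) \<Longrightarrow>
      P s \<Longrightarrow> P t \<Longrightarrow> P (s \<ominus>\<^bsub>tensor_square K A\<^esub> t)"
  shows "P t"
proof -
  let ?c = "\<lambda>c. tensor_kernel K A A #>\<^bsub>pair_group A A\<^esub> c"
  obtain c where t: "t = ?c c" and c: "Poly_Mapping.keys c \<subseteq> carrier A \<times> carrier A"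
    using assms(1) by (auto simp: tensor_square_def RCOSETS_def)
  \<comment> \<open>The case of a difference needs both terms in the carrier, so membership is
    carried along in the induction.\<close>
  have "c \<in> carrier (pair_group A A) \<and> P (?c c)"
    using c
  proof (induction c rule: frag_induction)
    case zero
    have "?c 0 = tensor_kernel K A A" by (simp add: r_coset_def)
    with assms(2) show ?case by (simp add: tensor_square_def)
  next
    case (one x)
    then show ?case using pure_tensor[of "fst x" "snd x"] by (auto simp: pure_tensor_def)
  next
    case (diff a b)
    then have "P (?c (a - b))"
      unfolding tensor_square_minus_r_coset[OF conjunct1 conjunct1, OF diff]
      by (intro minus) (auto simp: tensor_square_def RCOSETS_def)
    moreover have "a - b \<in> carrier (pair_group A A)" using diff keys_diff[of a b] by auto
    ultimately show ?case by blast
  qed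
  with t show ?thesis by simp
qed

end

text \<open>The values of \<open>f\<close> on pairs extend to a homomorphism on the free abelian
  group. Biadditivity and balancedness say that it kills the tensor relations, so it factors through
  the quotient.\<close>

lemma (in bimodule) tensor_square_universal:
  assumes closed: "\<And>a b. a \<in> carrier A \<Longrightarrow> b \<in> carrier A \<Longrightarrow> f a b \<in> carrier N"
    and add_left: "\<And>a a' b. a \<in> carrier A \<Longrightarrow> a' \<in> carrier A \<Longrightarrow> b \<in> carrier A \<Longrightarrow>
      f (a \<oplus>\<^bsub>A\<^esub> a') b = f a b \<oplus>\<^bsub>N\<^esub> f a' b"
    and add_right: "\<And>a b b'. a \<in> carrier A \<Longrightarrow> b \<in> carrier A \<Longrightarrow> b' \<in> carrier A \<Longrightarrow>
      f a (b \<oplus>\<^bsub>A\<^esub> b') = f a b \<oplus>\<^bsub>N\<^esub> f a b'"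
    and balanced: "\<And>k a b. k \<in> carrier K \<Longrightarrow> a \<in> carrier A \<Longrightarrow> b \<in> carrier A \<Longrightarrow>
      f (k \<odot>\<^bsub>A\<^esub> a) b = f a (k \<odot>\<^bsub>A\<^esub> b)"
  obtains g where "g \<in> hom (add_monoid (tensor_square K A)) (add_monoid N)"
    and "\<And>a b. a \<in> carrier A \<Longrightarrow> b \<in> carrier A \<Longrightarrow> g (pure_tensor K A A a b) = f a b"
proof -
  have "case_prod f ` (carrier A \<times> carrier A) \<subseteq> carrier (add_monoid N)" using closed by auto
  from comm_group.free_Abelian_group_universal[OF N.M.a_comm_group this]
  obtain h where h: "h \<in> hom (pair_group A A) (add_monoid N)"
    and hf: "\<And>x. x \<in> carrier A \<times> carrier A \<Longrightarrow> h (frag_of x) = case_prod f x"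
    by metis
  interpret h: group_hom "pair_group A A" "add_monoid N" h
    by (simp add: group_hom_def group_hom_axioms_def h N.M.a_group)
  have hd: "h (c - d) = h c \<ominus>\<^bsub>N\<^esub> h d"
    if "c \<in> carrier (pair_group A A)" "d \<in> carrier (pair_group A A)" for c d
    using h.hom_mult[of c "- d"] h.hom_inv[of d] that
    by (simp add: a_minus_def a_inv_def)
  have dcl: "c - d \<in> carrier (pair_group A A)"
    if "c \<in> carrier (pair_group A A)" "d \<in> carrier (pair_group A A)" for c d
    using that keys_diff[of c d] by auto
  have fcl: "frag_of (a, b) \<in> carrier (pair_group A A)" if "a \<in> carrier A" "b \<in> carrier A" for a b
    using that by simp
  have "h c = \<zero>\<^bsub>N\<^esub>" if "c \<in> tensor_relations K A A" for c
    using that unfolding tensor_relations_def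
    by (auto simp: hd dcl fcl hf closed add_left add_right balanced N.M.minus_eq[of "f _ _" "f _ _"]
        N.M.r_neg N.M.add_minus_minus_cancel simp del: carrier_free_Abelian_group_iff)
  then have "tensor_relations K A A \<subseteq> kernel (pair_group A A) (add_monoid N) h"
    using A.tensor_relations_carrier
    by (auto simp: kernel_def simp del: carrier_free_Abelian_group_iff)
  then have k: "tensor_kernel K A A \<subseteq> kernel (pair_group A A) (add_monoid N) h"
    unfolding tensor_kernel_def by (rule h.generate_subgroup_incl[OF _ h.subgroup_kernel])
  have "tensor_kernel K A A \<lhd> pair_group A A"
    using comm_group.normal_iff_subgroup[OF abelian_free_Abelian_group] A.subgroup_tensor_kernel
    by blast
  from h.FactGroup_universal_kernel[OF this k] obtain g
    where g: "g \<in> hom (pair_group A A Mod tensor_kernel K A A) (add_monoid N)"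
      and gh: "\<And>c. c \<in> carrier (pair_group A A) \<Longrightarrow>
        g (tensor_kernel K A A #>\<^bsub>pair_group A A\<^esub> c) = h c"
    by blast
  show ?thesis
  proof
    show "g \<in> hom (add_monoid (tensor_square K A)) (add_monoid N)"
      using g by (simp add: hom_def FactGroup_def tensor_square_def)
    show "g (pure_tensor K A A a b) = f a b" if "a \<in> carrier A" "b \<in> carrier A" for a b
      using gh[of "frag_of (a, b)"] hf[of "(a, b)"] that by (simp add: pure_tensor_def)
  qed
qed

section \<open>An additive retraction onto \<open>M\<close>\<close>

context derivation
begin

lemma D_one: "D \<one>\<^bsub>A\<^esub> = \<zero>\<^bsub>M\<^esub>"
  using D_mult[of "\<one>\<^bsub>A\<^esub>" "\<one>\<^bsub>A\<^esub>"] D_closed[of "\<one>\<^bsub>A\<^esub>"] by (simp add: lact_one ract_one)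

text \<open>The universal property turns the balanced map sending (a, b) to D(a)b into a
  homomorphism \<open>t\<close>, and \<open>g\<close> sends (s, m) to m - t(s). The retraction is
  stated before passing to the quotient: vanishing on \<open>derivation_kernel\<close> is what lets
  it descend to E_D.\<close>

lemma derivation_retraction:
  obtains g where "g \<in> hom (add_monoid derivation_sum) (add_monoid M)"
    and "\<And>a b m. a \<in> carrier A \<Longrightarrow> b \<in> carrier A \<Longrightarrow> m \<in> carrier M \<Longrightarrow>
      g (pure_tensor K A A a b, m) = m \<ominus>\<^bsub>M\<^esub> ract M (D a) b"
    and "\<And>m. m \<in> carrier M \<Longrightarrow> g (\<zero>\<^bsub>tensor_square K A\<^esub>, m) = m"
    and "\<And>x. x \<in> derivation_kernel \<Longrightarrow> g x = \<zero>\<^bsub>M\<^esub>"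
proof -
  obtain t where t: "t \<in> hom (add_monoid (tensor_square K A)) (add_monoid M)"
    and tp: "\<And>a b. a \<in> carrier A \<Longrightarrow> b \<in> carrier A \<Longrightarrow>
      t (pure_tensor K A A a b) = ract M (D a) b"
    by (rule tensor_square_universal[of "\<lambda>a b. ract M (D a) b"])
      (auto simp: ract_closed D_closed D_add ract_add_left ract_add_right D_smult ract_smult
        ract_smult_left)
  interpret t: group_hom "add_monoid (tensor_square K A)" "add_monoid M" t
    by (simp add: group_hom_def group_hom_axioms_def t T.N.M.a_group N.M.a_group)
  have tc: "t s \<in> carrier M" if "s \<in> carrier (tensor_square K A)" for s
    using t.hom_closed that by simp
  have ta: "t (s \<oplus>\<^bsub>tensor_square K A\<^esub> s') = t s \<oplus>\<^bsub>M\<^esub> t s'"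
    if "s \<in> carrier (tensor_square K A)" "s' \<in> carrier (tensor_square K A)" for s s'
    using t.hom_mult that by simp
  have tm: "t (s \<ominus>\<^bsub>tensor_square K A\<^esub> s') = t s \<ominus>\<^bsub>M\<^esub> t s'"
    if "s \<in> carrier (tensor_square K A)" "s' \<in> carrier (tensor_square K A)" for s s'
    using ta[OF that(1) T.N.M.a_inv_closed[OF that(2)]] t.hom_inv that
    by (simp add: a_minus_def a_inv_def)
  have tz: "t \<zero>\<^bsub>tensor_square K A\<^esub> = \<zero>\<^bsub>M\<^esub>" using t.hom_one by simp
  define g where "g = (\<lambda>(s, m). m \<ominus>\<^bsub>M\<^esub> t s)"
  have hom: "g \<in> hom (add_monoid derivation_sum) (add_monoid M)"
    by (auto simp: hom_def g_def sum_bimodule_def tc ta N.M.minus_eq N.M.minus_add N.M.a_ac)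
  show ?thesis
  proof
    show "g \<in> hom (add_monoid derivation_sum) (add_monoid M)" by (rule hom)
    show "g (pure_tensor K A A a b, m) = m \<ominus>\<^bsub>M\<^esub> ract M (D a) b"
      if "a \<in> carrier A" "b \<in> carrier A" "m \<in> carrier M" for a b m
      using that by (simp add: g_def tp)
    show "g (\<zero>\<^bsub>tensor_square K A\<^esub>, m) = m" if "m \<in> carrier M" for m
      using that by (simp add: g_def tz N.M.minus_eq N.M.a_inv_zero)
    \<comment> \<open>The value on a relation is D(a)b - (D(a)b - D(1)ab), which is zero because
      D(1) = 0.\<close>
    have "g r = \<zero>\<^bsub>M\<^esub>" if "r \<in> derivation_relations K A M D" for r
      using that unfolding derivation_relations_def
      by (auto simp: g_def tm tp A.pure_tensor_closed D_one D_closed ract_zero ract_closed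
          N.M.minus_eq N.M.a_inv_zero N.M.r_neg)
    then show "g x = \<zero>\<^bsub>M\<^esub>" if "x \<in> derivation_kernel" for x
      using S.N.M.generate_subset_kernel[OF N.M.abelian_group_axioms hom
          derivation_relations_carrier _ that] by blast
  qed
qed

section \<open>Commuting with \<open>z\<close> in E_D, tested on representatives\<close>

lemma derivation_bimodule_actions_agree_iff:
  assumes z: "z \<in> carrier A" and s: "s \<in> carrier derivation_sum"
  shows "lact (derivation_bimodule K A M D) z (derivation_kernel +>\<^bsub>derivation_sum\<^esub> s) =
      ract (derivation_bimodule K A M D) (derivation_kernel +>\<^bsub>derivation_sum\<^esub> s) z \<longleftrightarrow>
    lact derivation_sum z s \<ominus>\<^bsub>derivation_sum\<^esub> ract derivation_sum s z \<in> derivation_kernel"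
proof -
  note * = S.quot_actions_r_coset[OF derivation_kernel_subgroup z s]
  show ?thesis
    unfolding derivation_bimodule_def
      *(1)[OF derivation_kernel_lact[OF z] derivation_kernel_ract[OF z], simplified]
      *(2)[OF derivation_kernel_lact[OF z] derivation_kernel_ract[OF z], simplified]
    by (rule S.N.M.a_r_coset_eq_iff[OF derivation_kernel_subgroup S.lact_closed[OF z s]
          S.ract_closed[OF z s]])
qed

lemma derivation_bimodule_carrier:
  "carrier (derivation_bimodule K A M D) =
    (\<lambda>s. derivation_kernel +>\<^bsub>derivation_sum\<^esub> s) ` carrier derivation_sum"
  by (auto simp: derivation_bimodule_def quot_bimodule_def A_RCOSETS_def RCOSETS_def a_r_coset_def)

text \<open>Negatives in the sum are given only as inverses, so the difference is identified by
  adding the subtrahend back.\<close>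

lemma sum_minus:
  assumes "s \<in> carrier (tensor_square K A)" "s' \<in> carrier (tensor_square K A)"
    "m \<in> carrier M" "m' \<in> carrier M"
  shows "(s, m) \<ominus>\<^bsub>derivation_sum\<^esub> (s', m') = (s \<ominus>\<^bsub>tensor_square K A\<^esub> s', m \<ominus>\<^bsub>M\<^esub> m')"
proof -
  let ?d = "(s \<ominus>\<^bsub>tensor_square K A\<^esub> s', m \<ominus>\<^bsub>M\<^esub> m')"
  have "?d \<oplus>\<^bsub>derivation_sum\<^esub> (s', m') = (s, m)"
    using assms by (simp add: sum_bimodule_def T.N.M.minus_eq T.N.M.a_assoc T.N.M.l_neg
        N.M.minus_eq N.M.a_assoc N.M.l_neg)
  moreover have "?d \<in> carrier derivation_sum" "(s, m) \<in> carrier derivation_sum"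
    "(s', m') \<in> carrier derivation_sum"
    using assms by (auto simp: sum_bimodule_def)
  ultimately show ?thesis by (metis S.N.M.add.inv_solve_right S.N.M.minus_eq)
qed

section \<open>The two inclusions\<close>

text \<open>The map \<open>g\<close> is constant on cosets of \<open>derivation_kernel\<close>, so
  it takes the same value on zs and sz. The choices s = (0, m) and s = (1 \<otimes> 1, 0) give the
  two claims.\<close>

lemma rel_center_derivation_bimoduleD:
  assumes "z \<in> rel_center A (derivation_bimodule K A M D)"
  shows "z \<in> rel_center A M" and "D z = \<zero>\<^bsub>M\<^esub>"
proof -
  let ?p = "pure_tensor K A A" and ?T = "tensor_square K A"
  have zc: "z \<in> ring_center A" and z: "z \<in> carrier A"
    using assms by (auto simp: rel_center_def ring_center_def)
  obtain g where g: "g \<in> hom (add_monoid derivation_sum) (add_monoid M)"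
    and gp: "\<And>a b m. a \<in> carrier A \<Longrightarrow> b \<in> carrier A \<Longrightarrow> m \<in> carrier M \<Longrightarrow>
      g (?p a b, m) = m \<ominus>\<^bsub>M\<^esub> ract M (D a) b"
    and gm: "\<And>m. m \<in> carrier M \<Longrightarrow> g (\<zero>\<^bsub>?T\<^esub>, m) = m"
    and gk: "\<And>x. x \<in> derivation_kernel \<Longrightarrow> g x = \<zero>\<^bsub>M\<^esub>"
    using derivation_retraction by blast
  interpret g: group_hom "add_monoid derivation_sum" "add_monoid M" g
    by (simp add: group_hom_def group_hom_axioms_def g S.N.M.a_group N.M.a_group)
  have gd: "g x = g y" if "x \<ominus>\<^bsub>derivation_sum\<^esub> y \<in> derivation_kernel"
    "x \<in> carrier derivation_sum" "y \<in> carrier derivation_sum" for x y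
  proof -
    have "g x = g ((x \<ominus>\<^bsub>derivation_sum\<^esub> y) \<oplus>\<^bsub>derivation_sum\<^esub> y)"
      using that by (simp add: S.N.M.minus_eq S.N.M.a_assoc S.N.M.l_neg)
    also have "\<dots> = g (x \<ominus>\<^bsub>derivation_sum\<^esub> y) \<oplus>\<^bsub>M\<^esub> g y"
      using g.hom_mult[of "x \<ominus>\<^bsub>derivation_sum\<^esub> y" y] that by simp
    also have "\<dots> = g y" using gk[OF that(1)] g.hom_closed[of y] that by simp
    finally show ?thesis .
  qed
  have eq: "g (lact derivation_sum z s) = g (ract derivation_sum s z)"
    if s: "s \<in> carrier derivation_sum" for s
    using assms s derivation_bimodule_actions_agree_iff[OF z s]
    by (intro gd S.lact_closed[OF z s] S.ract_closed[OF z s])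
      (auto simp: rel_center_def derivation_bimodule_carrier)
  have "lact M z m = ract M m z" if m: "m \<in> carrier M" for m
  proof -
    show ?thesis
      using eq[of "(\<zero>\<^bsub>?T\<^esub>, m)"] gm z m
      by (simp add: sum_bimodule_def T.lact_zero T.ract_zero lact_closed ract_closed)
  qed
  then show "z \<in> rel_center A M" using zc by (simp add: rel_center_def)
  \<comment> \<open>The left action gives z \<otimes> 1, with value -D(z); the right action gives 1
    \<otimes> z, with value -D(1)z = 0.\<close>
  have "\<zero>\<^bsub>M\<^esub> \<ominus>\<^bsub>M\<^esub> D z = \<zero>\<^bsub>M\<^esub>"
    using eq[of "(?p \<one>\<^bsub>A\<^esub> \<one>\<^bsub>A\<^esub>, \<zero>\<^bsub>M\<^esub>)"] z
    by (simp add: sum_bimodule_def A.pure_tensor_closed A.lact_pure_tensor A.ract_pure_tensor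
        gp lact_zero ract_zero D_one D_closed ract_one N.M.minus_eq)
  then show "D z = \<zero>\<^bsub>M\<^esub>"
    using D_closed[OF z] by (metis N.M.add.inv_eq_1_iff N.M.a_inv_closed N.M.l_zero N.M.minus_eq)
qed

text \<open>Commuting with \<open>z\<close> modulo \<open>derivation_kernel\<close> is preserved by
  differences, so only the elements (0, m) and (a \<otimes> b, 0) have to be tested.\<close>

lemma rel_center_derivation_bimoduleI:
  assumes zM: "z \<in> rel_center A M" and Dz: "D z = \<zero>\<^bsub>M\<^esub>"
  shows "z \<in> rel_center A (derivation_bimodule K A M D)"
proof -
  let ?p = "pure_tensor K A A" and ?T = "tensor_square K A"
  have z: "z \<in> carrier A" and zA: "\<And>a. a \<in> carrier A \<Longrightarrow> z \<otimes>\<^bsub>A\<^esub> a = a \<otimes>\<^bsub>A\<^esub> z"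
    and zm: "\<And>m. m \<in> carrier M \<Longrightarrow> lact M z m = ract M m z"
    using zM by (auto simp: rel_center_def ring_center_def)
  let ?S = derivation_sum
  define P where "P s \<longleftrightarrow> lact ?S z s \<ominus>\<^bsub>?S\<^esub> ract ?S s z \<in> derivation_kernel" for s
  have diff: "x \<ominus>\<^bsub>?S\<^esub> y \<in> derivation_kernel"
    if "x \<in> derivation_kernel" "y \<in> derivation_kernel" for x y
    using subgroup.m_closed[OF derivation_kernel_subgroup that(1)
        subgroup.m_inv_closed[OF derivation_kernel_subgroup that(2)]]
    by (simp add: a_minus_def a_inv_def)
  have Pminus: "P (x \<ominus>\<^bsub>?S\<^esub> y)" if "x \<in> carrier ?S" "y \<in> carrier ?S" "P x" "P y" for x y
    using that diff by (simp add: P_def S.commutator_minus[OF z])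
  have cl: "(t, m) \<in> carrier ?S" if "t \<in> carrier ?T" "m \<in> carrier M" for t m
    using that by (simp add: sum_bimodule_def)
  have PM: "P (\<zero>\<^bsub>?T\<^esub>, m)" if m: "m \<in> carrier M" for m
  proof -
    have "lact ?S z (\<zero>\<^bsub>?T\<^esub>, m) = ract ?S (\<zero>\<^bsub>?T\<^esub>, m) z"
      using m by (simp add: sum_bimodule_def T.lact_zero[OF z] T.ract_zero[OF z] zm)
    then show ?thesis
      using S.ract_closed[OF z cl[OF T.N.M.zero_closed m]]
        subgroup.one_closed[OF derivation_kernel_subgroup]
      by (simp add: P_def S.N.M.minus_eq S.N.M.r_neg)
  qed
  have PT: "P (t, \<zero>\<^bsub>M\<^esub>)" if "t \<in> carrier ?T" for t
    using that
  proof (induction rule: A.tensor_square_induct)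
    case zero
    show ?case by (rule PM) simp
  next
    case (pure_tensor a b)
    let ?r = "\<lambda>a b. (?p a b \<ominus>\<^bsub>?T\<^esub> ?p \<one>\<^bsub>A\<^esub> (a \<otimes>\<^bsub>A\<^esub> b), ract M (D a) b)"
    \<comment> \<open>As D(z) = 0, the Leibniz rule gives D(za) = zD(a); then \<open>z\<close> moves
      past D(a)b because it centralizes \<open>M\<close>.\<close>
    have D: "ract M (D (z \<otimes>\<^bsub>A\<^esub> a)) b = ract M (D a) (b \<otimes>\<^bsub>A\<^esub> z)"
      using pure_tensor z
      by (simp add: D_mult Dz D_closed ract_zero lact_closed ract_closed lact_ract[symmetric]
          ract_mult) (simp add: zm D_closed ract_closed)
    have zab: "(z \<otimes>\<^bsub>A\<^esub> a) \<otimes>\<^bsub>A\<^esub> b = a \<otimes>\<^bsub>A\<^esub> (b \<otimes>\<^bsub>A\<^esub> z)"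
      using pure_tensor z zA[of "a \<otimes>\<^bsub>A\<^esub> b"] by (simp add: A.m_assoc)
    have "lact ?S z (?p a b, \<zero>\<^bsub>M\<^esub>) \<ominus>\<^bsub>?S\<^esub> ract ?S (?p a b, \<zero>\<^bsub>M\<^esub>) z =
        (?p (z \<otimes>\<^bsub>A\<^esub> a) b, \<zero>\<^bsub>M\<^esub>) \<ominus>\<^bsub>?S\<^esub> (?p a (b \<otimes>\<^bsub>A\<^esub> z), \<zero>\<^bsub>M\<^esub>)"
      using pure_tensor z
      by (simp add: sum_bimodule_def A.lact_pure_tensor A.ract_pure_tensor lact_zero ract_zero)
    \<comment> \<open>The relations compare za \<otimes> b with 1 \<otimes> zab and a \<otimes> bz
      with 1 \<otimes> abz. The latter tensors agree since \<open>z\<close> is central, and the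
      components in \<open>M\<close> agree by the fact \<open>D\<close>.\<close>
    also have "\<dots> = ?r (z \<otimes>\<^bsub>A\<^esub> a) b \<ominus>\<^bsub>?S\<^esub> ?r a (b \<otimes>\<^bsub>A\<^esub> z)"
      using pure_tensor z
      by (simp add: sum_minus A.pure_tensor_closed D_closed ract_closed zab D
          T.N.M.minus_minus_cancel_right N.M.minus_eq N.M.r_neg)
    also have "\<dots> \<in> derivation_kernel"
      using pure_tensor z by (intro diff derivation_kernel_rel) auto
    finally show ?case by (simp add: P_def)
  next
    case (minus s t)
    then show ?case
      using Pminus[OF cl cl, of s "\<zero>\<^bsub>M\<^esub>" t "\<zero>\<^bsub>M\<^esub>"] by (simp add: sum_minus N.M.minus_eq N.M.a_inv_zero)
  qed
  have "P (t, m)" if t: "t \<in> carrier ?T" and m: "m \<in> carrier M" for t m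
  proof -
    \<comment> \<open>The sum is written as a difference because \<open>Pminus\<close> gives closure
      under differences.\<close>
    have "(t, \<zero>\<^bsub>M\<^esub>) \<ominus>\<^bsub>?S\<^esub> (\<zero>\<^bsub>?T\<^esub>, \<ominus>\<^bsub>M\<^esub> m) = (t, m)"
      using t m by (simp add: sum_minus T.N.M.minus_eq N.M.minus_eq)
    then show ?thesis
      using Pminus[OF cl cl PT PM, of t "\<ominus>\<^bsub>M\<^esub> m"] t m by simp
  qed
  then have "P s" if "s \<in> carrier ?S" for s
    using that by (auto simp: sum_bimodule_def)
  then show ?thesis
    using zM derivation_bimodule_actions_agree_iff[OF z]
    by (auto simp: rel_center_def P_def derivation_bimodule_carrier)
qed

end

theorem mainTheorem4:
  fixes K :: "('k, 'c) ring_scheme"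
    and A :: "('k, 'a, 'd) module_scheme"
    and M :: "('k, 'a, 'm, 'e) bimodule_scheme"
    and D :: "'a \<Rightarrow> 'm"
  assumes "cring K"
    and "assoc_algebra K A"
    and "bimodule K A M"
    and "derivation K A M D"
  shows "a_kernel A M D \<inter> rel_center A M =
      a_kernel (A\<lparr>carrier := rel_center A M\<rparr>) M (restrict D (rel_center A M)) \<and>
    a_kernel (A\<lparr>carrier := rel_center A M\<rparr>) M (restrict D (rel_center A M)) =
      rel_center A (derivation_bimodule K A M D)"
proof -
  interpret derivation K A M D by fact
  have "a_kernel A M D \<inter> rel_center A M = {z \<in> rel_center A M. D z = \<zero>\<^bsub>M\<^esub>}"
    by (auto simp: a_kernel_def' rel_center_def ring_center_def)
  \<comment> \<open>On the shrunken carrier \<open>restrict\<close> agrees with \<open>D\<close>, so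
    this kernel consists of the elements of the relative center killed by \<open>D\<close>.\<close>
  moreover have "a_kernel (A\<lparr>carrier := rel_center A M\<rparr>) M (restrict D (rel_center A M)) =
      {z \<in> rel_center A M. D z = \<zero>\<^bsub>M\<^esub>}"
    by (auto simp: a_kernel_def')
  moreover have "rel_center A (derivation_bimodule K A M D) =
      {z \<in> rel_center A M. D z = \<zero>\<^bsub>M\<^esub>}"
    using rel_center_derivation_bimoduleD rel_center_derivation_bimoduleI by blast
  ultimately show ?thesis by simp
qed

end
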